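(* Let $p>0$ and $a,b,c,\nu\in\mathbb{C}$ with $\Re(c)>\Re(b)>0$. Then, for $|\arg(1-z)|<\pi$, $$F_{p,\nu}(a,b;c;z) =(1-z)^{-a}\,F_{p,\nu}\left(a,c-b;c;-\frac{z}{1-z}\right),$$ and, for all $z\in\mathbb{C}$, $$\Phi_{p,\nu}(b;c;z) = e^z\,\Phi_{p,\nu}(c-b;c;-z).$$
   Context: $K_\mu(z)$ denotes the modified Bessel function of the second kind of order $\mu$; $B(x,y)$ (two arguments) is the classical Beta function; $(a)_n$ is the Pochhammer symbol $(a)_0=1$, $(a)_n=a(a+1)\cdots(a+n-1)$. For $p>0$ the extended Beta function is $$B_{\nu}(x,y;p):= \sqrt{\frac{2p}{\pi}}\int_{0}^{1} t^{x-\frac{3}{2}}(1-t)^{y-\frac{3}{2}}\, K_{\nu+\frac{1}{2}}\left(\frac{p}{t(1-t)}\right)dt .$$ For $\Re(c)>\Re(b)>0$ define $$F_{p,\nu}(a,b;c;z):=\sum_{n=0}^\infty(a)_n\,\frac{B_{\nu}(b+n,c-b;p)}{B(b,c-b)}\,\frac{z^n}{n!}\quad(|z|<1),$$ extended to $|\arg(1-z)|<\pi$ (i.e. $z\in\mathbb{C}\setminus[1,\infty)$) by analytic continuation; equivalently, on that domain, $$F_{p,\nu}(a,b;c;z)=\sqrt{\frac{2p}{\pi}}\,\frac{1}{B(b,c-b)}\int_0^1 t^{b-\frac{3}{2}}(1-t)^{c-b-\frac{3}{2}}(1-zt)^{-a}\, K_{\nu+\frac{1}{2}}\left(\frac{p}{t(1-t)}\right)dt.$$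 Also $$\Phi_{p,\nu}(b;c;z):=\sum_{n=0}^\infty \frac{B_{\nu}(b+n,c-b;p)}{B(b,c-b)}\,\frac{z^n}{n!}\quad(z\in\mathbb{C}).$$ Powers take principal values. *)

theory Defs
  imports "HOL-Complex_Analysis.Complex_Analysis"
begin

text \<open>Modified Bessel function of the second kind, by its standard integral representation.
  The integral converges for \<open>Re z > 0\<close>; below the argument is always a positive real.\<close>

definition bessel_K :: "complex \<Rightarrow> complex \<Rightarrow> complex" where
  "bessel_K \<mu> z =
     integral {0..} (\<lambda>t::real. exp (- z * cosh (complex_of_real t)) * cosh (\<mu> * complex_of_real t))"

definition ext_Beta :: "complex \<Rightarrow> complex \<Rightarrow> complex \<Rightarrow> real \<Rightarrow> complex" where
  "ext_Beta \<nu> x y p =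
     complex_of_real (sqrt (2 * p / pi)) *
     integral {0..1} (\<lambda>t::real.
       complex_of_real t powr (x - 3/2) * complex_of_real (1 - t) powr (y - 3/2) *
       bessel_K (\<nu> + 1/2) (complex_of_real (p / (t * (1 - t)))))"

text \<open>The domain \<open>|arg (1 - z)| < \<pi>\<close>. It is not written with \<open>Arg\<close> because \<open>Arg 0 = 0\<close>
  would admit \<open>z = 1\<close>.\<close>

definition cut_plane :: "complex set" where
  "cut_plane = UNIV - complex_of_real ` {1..}"

definition ext_hypergeo_series ::
    "real \<Rightarrow> complex \<Rightarrow> complex \<Rightarrow> complex \<Rightarrow> complex \<Rightarrow> complex \<Rightarrow> complex" where
  "ext_hypergeo_series p \<nu> a b c z =
     (\<Sum>n. pochhammer a n * (ext_Beta \<nu> (b + of_nat n) (c - b) p / Beta b (c - b)) * (z ^ n / fact n))"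

text \<open>The value at \<open>z\<close> of the analytic continuation of the series from the unit disc to the
  cut plane; it is unique because the cut plane is connected.\<close>

definition ext_hypergeo ::
    "real \<Rightarrow> complex \<Rightarrow> complex \<Rightarrow> complex \<Rightarrow> complex \<Rightarrow> complex \<Rightarrow> complex" where
  "ext_hypergeo p \<nu> a b c z =
     (THE w. \<exists>f. f holomorphic_on cut_plane \<and>
        (\<forall>u\<in>ball 0 1. f u = ext_hypergeo_series p \<nu> a b c u) \<and> w = f z)"

definition ext_confluent ::
    "real \<Rightarrow> complex \<Rightarrow> complex \<Rightarrow> complex \<Rightarrow> complex \<Rightarrow> complex" where
  "ext_confluent p \<nu> b c z =
     (\<Sum>n. ext_Beta \<nu> (b + of_nat n) (c - b) p / Beta b (c - b) * (z ^ n / fact n))"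

end

theory Submission imports Defs "HOL-Real_Asymp.Real_Asymp" begin

text \<open>Since \<open>K\<^sub>\<mu> x\<close> is \<open>O (exp (- x))\<close> and \<open>p / (t * (1 - t)) = p / t + p / (1 - t)\<close>, the kernel of
  the extended Beta integral is continuous on \<open>[0, 1]\<close>, whatever the exponents. Summing under the
  integral turns the two series into Euler-type integrals of \<open>(1 - z * t) powr (- a)\<close> and
  \<open>exp (z * t)\<close> against this kernel; the first is holomorphic on the cut plane, hence is the
  analytic continuation. Both identities then follow from the substitution \<open>t \<mapsto> 1 - t\<close>, which
  swaps the two exponents of the kernel and leaves its Bessel factor unchanged.\<close>

section \<open>Decay and continuity of the Bessel function on the positive half-line\<close>

lemma norm_cosh_le: "norm (cosh w) \<le> exp \<bar>Re w\<bar>" for w :: complex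
proof -
  have "norm (cosh w) \<le> (norm (exp w) + norm (exp (- w))) / 2"
    unfolding cosh_field_def norm_divide
    by (simp only: norm_numeral divide_right_mono norm_triangle_ineq zero_le_numeral)
  also have "\<dots> \<le> exp \<bar>Re w\<bar>"
    by (cases "Re w \<ge> 0") (simp_all add: field_simps)
  finally show ?thesis .
qed

lemma cosh_complex_of_real: "cosh (complex_of_real t) = complex_of_real (cosh t)"
  by (simp add: cosh_field_def exp_of_real flip: of_real_minus)

text \<open>Completing the square in \<open>t\<close>, after \<open>cosh t \<ge> t\<^sup>2 / 4\<close>, absorbs the growth of the factor
  \<open>cosh (\<mu> * t)\<close>.\<close>

lemma bessel_K_integrand_bound:
  fixes x0 :: real and \<mu> :: complex
  assumes "x0 > 0"
  obtains C where "C \<ge> 0"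
    "\<And>x t. x \<ge> x0 \<Longrightarrow> t \<ge> 0 \<Longrightarrow>
       norm (exp (- complex_of_real x * cosh (complex_of_real t)) * cosh (\<mu> * complex_of_real t))
         \<le> C * exp (- (x - x0)) * exp (- t)"
proof
  \<comment> \<open>The summand 1 is spare growth: after
    \<open>exp (\<bar>Re \<mu>\<bar> * t)\<close> has been absorbed, it leaves the integrable factor
    \<open>exp (- t)\<close>.\<close>
  define m where "m = \<bar>Re \<mu>\<bar> + 1"
  show "0 \<le> exp (m\<^sup>2 / x0)" by simp
  fix x t :: real assume x: "x \<ge> x0" and t: "t \<ge> 0"
  have ch: "cosh t \<ge> 1" by (rule cosh_real_ge_1)
  have "1 + t + t\<^sup>2 / 2 \<le> exp t" using t by (rule exp_lower_Taylor_quadratic)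
  moreover have "cosh t \<ge> exp t / 2" by (simp add: cosh_field_def)
  ultimately have "cosh t \<ge> t\<^sup>2 / 4" using t by simp
  then have "x0 * cosh t \<ge> x0 * (t\<^sup>2 / 4)"
    using assms by (intro mult_left_mono) auto
  moreover have "x0 * (t\<^sup>2 / 4) - m * t + m\<^sup>2 / x0 = x0 * (t / 2 - m / x0)\<^sup>2"
    using assms by (simp add: field_simps power2_eq_square)
  moreover have "x0 * (t / 2 - m / x0)\<^sup>2 \<ge> 0" using assms by simp
  ultimately have 1: "x0 * cosh t \<ge> m * t - m\<^sup>2 / x0" by linarith
  \<comment> \<open>Only the share \<open>x0 * cosh t\<close> of the exponent is spent on the growth
    in \<open>t\<close>; the surplus, with \<open>cosh t\<close> at least 1, supplies the decay in
    \<open>x\<close>.\<close>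
  have "(x - x0) * cosh t \<ge> (x - x0) * 1"
    using x ch by (intro mult_left_mono) auto
  with 1 have 2: "- (x * cosh t) + \<bar>Re \<mu>\<bar> * t \<le> m\<^sup>2 / x0 + - (x - x0) + - t"
    by (simp add: m_def algebra_simps)
  have "norm (exp (- complex_of_real x * cosh (complex_of_real t)) * cosh (\<mu> * complex_of_real t))
      \<le> exp (- (x * cosh t)) * exp (\<bar>Re \<mu>\<bar> * t)"
    unfolding norm_mult
  proof (rule mult_mono)
    show "norm (cosh (\<mu> * complex_of_real t)) \<le> exp (\<bar>Re \<mu>\<bar> * t)"
      using norm_cosh_le[of "\<mu> * complex_of_real t"] t by (simp add: abs_mult)
  qed (simp_all add: cosh_complex_of_real)
  also have "\<dots> \<le> exp (m\<^sup>2 / x0) * exp (- (x - x0)) * exp (- t)"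
    using 2 by (simp flip: exp_add)
  finally show "norm (exp (- complex_of_real x * cosh (complex_of_real t)) *
      cosh (\<mu> * complex_of_real t)) \<le> exp (m\<^sup>2 / x0) * exp (- (x - x0)) * exp (- t)" .
qed

lemma exp_minus_integrable: "(\<lambda>t::real. C * exp (- t)) integrable_on {0..}" for C :: real
  using integrable_on_cmult_left[OF integrable_on_exp_minus_to_infinity[of 1 0], of C] by simp

lemma bessel_K_integrable:
  fixes x :: real
  assumes "x > 0"
  shows "(\<lambda>t. exp (- complex_of_real x * cosh (complex_of_real t)) * cosh (\<mu> * complex_of_real t))
           integrable_on {0..}"
proof -
  \<comment> \<open>The uniform bound is applied at \<open>x = x0\<close>, where the factor
    \<open>exp (- (x - x0))\<close> equals 1.\<close>
  obtain C where "\<And>t. t \<ge> 0 \<Longrightarrow>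
      norm (exp (- complex_of_real x * cosh (complex_of_real t)) * cosh (\<mu> * complex_of_real t))
        \<le> C * exp (- t)"
    using bessel_K_integrand_bound[OF assms, of \<mu>]
    by (metis diff_self exp_zero minus_zero mult.right_neutral order_refl)
  then show ?thesis
    by (intro measurable_bounded_by_integrable_imp_integrable[OF _ exp_minus_integrable[of C]]
          continuous_imp_measurable_on_sets_lebesgue continuous_intros) auto
qed

text \<open>Integrating the bound on the integrand over \<open>t\<close> leaves
  \<open>exp (- (x - x0))\<close>, whose part \<open>exp x0\<close> goes into the constant. This
  decay later beats the powers of \<open>t\<close> and \<open>1 - t\<close> at the endpoints of the
  Beta integral.\<close>

lemma bessel_K_exp_bound:
  assumes "x0 > 0"
  obtains C where "C \<ge> 0"
    "\<And>x::real. x \<ge> x0 \<Longrightarrow> norm (bessel_K \<mu> (complex_of_real x)) \<le> C * exp (- x)"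
proof -
  obtain C where C: "C \<ge> 0" "\<And>x t. x \<ge> x0 \<Longrightarrow> t \<ge> 0 \<Longrightarrow>
       norm (exp (- complex_of_real x * cosh (complex_of_real t)) * cosh (\<mu> * complex_of_real t))
         \<le> C * exp (- (x - x0)) * exp (- t)"
    using bessel_K_integrand_bound[OF assms] by metis
  let ?I = "integral {0..} (\<lambda>t::real. exp (- t))"
  have I: "?I \<ge> 0" by (rule integral_nonneg) (use exp_minus_integrable[of 1] in auto)
  show ?thesis
  proof
    show "C * exp x0 * ?I \<ge> 0" using C(1) I by simp
    fix x :: real assume x: "x \<ge> x0"
    have "norm (bessel_K \<mu> (complex_of_real x)) \<le> integral {0..} (\<lambda>t. C * exp (- (x - x0)) * exp (- t))"
      unfolding bessel_K_def
      using x assms C(2)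
      by (intro integral_norm_bound_integral bessel_K_integrable exp_minus_integrable) auto
    also have "\<dots> = C * exp x0 * ?I * exp (- x)"
      by (simp only: integral_mult_right) (simp add: exp_diff exp_minus field_simps)
    finally show "norm (bessel_K \<mu> (complex_of_real x)) \<le> C * exp x0 * ?I * exp (- x)" .
  qed
qed

text \<open>Dominated convergence along sequences in \<open>{x0..}\<close>: there
  \<open>exp (- (x - x0))\<close> is at most 1, so that the majorant \<open>C * exp (- t)\<close>
  does not depend on the sequence.\<close>

lemma continuous_on_bessel_K:
  "continuous_on {0<..} (\<lambda>x::real. bessel_K \<mu> (complex_of_real x))"
proof -
  have "continuous_on {x0..} (\<lambda>x::real. bessel_K \<mu> (complex_of_real x))" if x0: "x0 > 0" for x0
  proof (rule continuous_on_sequentiallyI)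
    fix u :: "nat \<Rightarrow> real" and x
    assume u: "\<forall>n. u n \<in> {x0..}" and x: "x \<in> {x0..}" and lim: "u \<longlonglongrightarrow> x"
    obtain C where C: "C \<ge> 0" "\<And>x t. x \<ge> x0 \<Longrightarrow> t \<ge> 0 \<Longrightarrow>
       norm (exp (- complex_of_real x * cosh (complex_of_real t)) * cosh (\<mu> * complex_of_real t))
         \<le> C * exp (- (x - x0)) * exp (- t)"
      using bessel_K_integrand_bound[OF x0] by metis
    show "(\<lambda>n. bessel_K \<mu> (complex_of_real (u n))) \<longlonglongrightarrow> bessel_K \<mu> (complex_of_real x)"
      unfolding bessel_K_def
    proof (rule dominated_convergence(2))
      show "(\<lambda>t::real. C * exp (- t)) integrable_on {0..}" by (rule exp_minus_integrable)
      fix n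
      show "(\<lambda>t. exp (- complex_of_real (u n) * cosh (complex_of_real t)) * cosh (\<mu> * complex_of_real t))
           integrable_on {0..}"
        using u x0 by (intro bessel_K_integrable) (meson atLeast_iff less_le_trans)
    next
      fix n and t :: real assume t: "t \<in> {0..}"
      have "norm (exp (- complex_of_real (u n) * cosh (complex_of_real t)) * cosh (\<mu> * complex_of_real t))
         \<le> C * exp (- (u n - x0)) * exp (- t)" using C(2) u t by simp
      also have "\<dots> \<le> C * 1 * exp (- t)"
        using u C(1) by (intro mult_right_mono mult_left_mono) auto
      finally show "norm (exp (- complex_of_real (u n) * cosh (complex_of_real t)) * cosh (\<mu> * complex_of_real t))
         \<le> C * exp (- t)" by simp
    next
      fix t :: real
      show "(\<lambda>n. exp (- complex_of_real (u n) * cosh (complex_of_real t)) * cosh (\<mu> * complex_of_real t))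
         \<longlonglongrightarrow> exp (- complex_of_real x * cosh (complex_of_real t)) * cosh (\<mu> * complex_of_real t)"
        by (intro tendsto_intros lim)
    qed
  qed
  \<comment> \<open>Each positive \<open>x\<close> is interior to the half-line starting at
    \<open>x / 2\<close>.\<close>
  then have "continuous (at x) (\<lambda>x::real. bessel_K \<mu> (complex_of_real x))" if "x > 0" for x
    using that by (intro continuous_on_interior[of "{x/2..}"]) auto
  then show ?thesis by (simp add: continuous_at_imp_continuous_on)
qed

section \<open>The kernel of the extended Beta integral\<close>

definition beta_kernel :: "real \<Rightarrow> complex \<Rightarrow> complex \<Rightarrow> complex \<Rightarrow> real \<Rightarrow> complex" where
  "beta_kernel p \<nu> x y t =
     complex_of_real t powr (x - 3/2) * complex_of_real (1 - t) powr (y - 3/2) *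
     bessel_K (\<nu> + 1/2) (complex_of_real (p / (t * (1 - t))))"

lemma ext_Beta_eq:
  "ext_Beta \<nu> x y p = complex_of_real (sqrt (2 * p / pi)) * integral {0..1} (beta_kernel p \<nu> x y)"
  by (simp only: ext_Beta_def beta_kernel_def [abs_def])

lemma beta_kernel_reflect: "beta_kernel p \<nu> x y (1 - t) = beta_kernel p \<nu> y x t"
  by (simp add: beta_kernel_def mult_ac)

text \<open>This makes the coefficients of both series moments of one fixed kernel, so that the
  series can be summed under the integral. At \<open>t = 0\<close> both sides vanish because
  \<open>0 powr _ = 0\<close>; this covers \<open>n = 0\<close>, where the power is 1.\<close>

lemma beta_kernel_add_of_nat:
  "beta_kernel p \<nu> (x + of_nat n) y t = of_real t ^ n * beta_kernel p \<nu> x y t"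
proof (cases "t = 0")
  case False
  have "x + of_nat n - 3/2 = (x - 3/2) + of_nat n" by simp
  then have "complex_of_real t powr (x + of_nat n - 3/2) = of_real t ^ n * of_real t powr (x - 3/2)"
    using False by (simp only: powr_add powr_nat' of_real_eq_0_iff) simp
  then show ?thesis by (simp only: beta_kernel_def mult_ac)
qed (simp add: beta_kernel_def)

text \<open>Continuity at \<open>0\<close> relies on \<open>0 powr \<alpha> = 0\<close> for every \<open>\<alpha>\<close>.\<close>

lemma continuous_on_powr_exp_inverse:
  fixes \<alpha> p :: real
  assumes "p > 0"
  shows "continuous_on {0..} (\<lambda>t. t powr \<alpha> * exp (- p / t))"
proof -
  have "continuous (at t within {0..}) (\<lambda>t. t powr \<alpha> * exp (- p / t))" if "t \<ge> 0" for t
  proof (cases "t = 0")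
    case True
    have "((\<lambda>t. t powr \<alpha> * exp (- p / t)) \<longlongrightarrow> 0) (at_right 0)"
      using assms by real_asymp
    then show ?thesis
      using True by (simp add: continuous_within at_within_Ici_at_right)
  next
    case False
    then show ?thesis using that by (intro continuous_intros) auto
  qed
  then show ?thesis by (simp add: continuous_on_eq_continuous_within)
qed

text \<open>Continuity inside is inherited from the factors. At the endpoints the kernel is squeezed
  to its value 0 by \<open>g\<close>, in which one exponential factor controls the power of
  \<open>t\<close> and the other that of \<open>1 - t\<close>.\<close>

lemma continuous_on_beta_kernel:
  assumes "p > 0"
  shows "continuous_on {0..1} (beta_kernel p \<nu> x y)"
proof -
  obtain C where C: "C \<ge> 0"
    "\<And>u::real. u \<ge> p \<Longrightarrow> norm (bessel_K (\<nu> + 1/2) (complex_of_real u)) \<le> C * exp (- u)"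
    using bessel_K_exp_bound[OF assms] by metis
  define g where "g = (\<lambda>t. C * (t powr (Re x - 3/2) * exp (- p / t)) *
       ((1 - t) powr (Re y - 3/2) * exp (- p / (1 - t))))"
  have g: "continuous_on {0..1} g"
    unfolding g_def
    by (intro continuous_intros continuous_on_compose2[OF continuous_on_powr_exp_inverse[OF assms]]) auto
  have inner: "continuous_on {0<..<1} (beta_kernel p \<nu> x y)"
    unfolding beta_kernel_def using assms
    by (intro continuous_intros continuous_on_compose2[OF continuous_on_bessel_K]) auto
  have bound: "norm (beta_kernel p \<nu> x y t) \<le> g t" if "t \<in> {0..1}" for t
  proof (cases "t \<in> {0<..<1}")
    case True
    then have t: "0 < t" "t < 1" by auto
    \<comment> \<open>The Bessel argument is thus at least \<open>p\<close>, the threshold for which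
      the constant \<open>C\<close> was chosen.\<close>
    have "t * (1 - t) \<le> 1 * 1" using t by (intro mult_mono) auto
    then have "p / (t * (1 - t)) \<ge> p"
      using t assms by (simp add: divide_simps)
    then have K: "norm (bessel_K (\<nu> + 1/2) (complex_of_real (p / (t * (1 - t)))))
        \<le> C * exp (- (p / (t * (1 - t))))" by (rule C(2))
    have *: "p / (t * (1 - t)) = p / t + p / (1 - t)" using t by (simp add: field_simps)
    have "norm (beta_kernel p \<nu> x y t) \<le> t powr (Re x - 3/2) * (1 - t) powr (Re y - 3/2) *
        (C * exp (- (p / (t * (1 - t)))))"
      unfolding beta_kernel_def norm_mult using t K
      by (intro mult_mono) (auto simp: norm_powr_real_powr simp flip: of_real_diff)
    also have "\<dots> = g t"
      by (simp only: * minus_add_distrib exp_add) (simp add: g_def)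
    finally show ?thesis .
  next
    case False
    with that have "t = 0 \<or> t = 1" by auto
    then show ?thesis by (auto simp: g_def beta_kernel_def)
  qed
  have "continuous (at t within {0..1}) (beta_kernel p \<nu> x y)" if t: "t \<in> {0..1}" for t
  proof (cases "t \<in> {0<..<1}")
    case True
    then show ?thesis using inner
      by (simp add: continuous_on_eq_continuous_at continuous_at_imp_continuous_at_within)
  next
    case False
    with t have e: "t = 0 \<or> t = 1" by auto
    then have z: "g t = 0" "beta_kernel p \<nu> x y t = 0" by (auto simp: g_def beta_kernel_def)
    have "(g \<longlongrightarrow> 0) (at t within {0..1})"
      using g t z by (metis continuous_on_def)
    then have "(beta_kernel p \<nu> x y \<longlongrightarrow> 0) (at t within {0..1})"
      by (rule Lim_null_comparison[rotated]) (auto simp: eventually_at_filter bound)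
    then show ?thesis using z by (simp add: continuous_within)
  qed
  then show ?thesis by (simp add: continuous_on_eq_continuous_within)
qed

section \<open>Termwise integration and reflection on the unit interval\<close>

lemma power_moments_sums:
  fixes k :: "real \<Rightarrow> complex" and d :: "nat \<Rightarrow> complex"
  assumes k: "continuous_on {0..1} k" and d: "summable (\<lambda>n. norm (d n))"
    and f: "\<And>t. t \<in> {0..1} \<Longrightarrow> (\<lambda>n. d n * of_real t ^ n) sums f t"
  shows "(\<lambda>n. d n * integral {0..1} (\<lambda>t. of_real t ^ n * k t)) sums integral {0..1} (\<lambda>t. f t * k t)"
proof -
  let ?S = "\<lambda>N t. \<Sum>n<N. d n * (of_real t ^ n * k t)"
  have int: "(\<lambda>t. of_real t ^ n * k t) integrable_on {0..1}" for n
    by (intro integrable_continuous_real continuous_intros k)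
  have "(\<lambda>N. integral {0..1} (?S N)) \<longlonglongrightarrow> integral {0..1} (\<lambda>t. f t * k t)"
  \<comment> \<open>Since \<open>t ^ n\<close> is at most 1 on the interval, the sum of all
    \<open>norm (d n)\<close>, times \<open>norm (k t)\<close>, dominates every partial sum.\<close>
  proof (rule dominated_convergence(2))
    show "?S N integrable_on {0..1}" for N
      by (intro integrable_continuous_real continuous_intros k)
    show "(\<lambda>t. (\<Sum>n. norm (d n)) * norm (k t)) integrable_on {0..1}"
      by (intro integrable_continuous_real continuous_intros k)
  next
    fix N and t :: real assume t: "t \<in> {0..1}"
    have "norm (?S N t) \<le> (\<Sum>n<N. norm (d n) * norm (k t))"
    proof (rule sum_norm_le)
      fix n
      have "t ^ n \<le> 1" using t by (simp add: power_le_one)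
      then show "norm (d n * (of_real t ^ n * k t)) \<le> norm (d n) * norm (k t)"
        using t by (simp add: norm_mult norm_power mult_left_mono mult_left_le_one_le)
    qed
    also have "\<dots> = (\<Sum>n<N. norm (d n)) * norm (k t)" by (simp add: sum_distrib_right)
    also have "\<dots> \<le> (\<Sum>n. norm (d n)) * norm (k t)"
      using d by (intro mult_right_mono sum_le_suminf) auto
    finally show "norm (?S N t) \<le> (\<Sum>n. norm (d n)) * norm (k t)" .
  next
    fix t :: real assume "t \<in> {0..1}"
    then have "(\<lambda>N. (\<Sum>n<N. d n * of_real t ^ n) * k t) \<longlonglongrightarrow> f t * k t"
      using f by (intro tendsto_intros) (simp add: sums_def)
    then show "(\<lambda>N. ?S N t) \<longlonglongrightarrow> f t * k t"
      by (simp add: sum_distrib_right mult.assoc)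
  qed
  moreover have "integral {0..1} (?S N) = (\<Sum>n<N. d n * integral {0..1} (\<lambda>t. of_real t ^ n * k t))" for N
    by (subst integral_sum) (auto intro!: integrable_on_mult_right int)
  ultimately show ?thesis by (simp add: sums_def)
qed

lemma integral_reflect01:
  fixes f :: "real \<Rightarrow> complex"
  assumes "continuous_on {0..1} f"
  shows "integral {0..1} (\<lambda>t. f (1 - t)) = integral {0..1} f"
proof -
  have "(f has_integral integral {0..1} f) {0..1}"
    using assms by (intro integrable_integral integrable_continuous_real)
  from has_integral_affinity01[OF this, of "-1" 1]
  have "((\<lambda>t. f (1 - t)) has_integral integral {0..1} f) ((\<lambda>t. 1 - t) ` {0..1})"
    by (simp add: add.commute)
  then show ?thesis by (simp add: integral_unique)
qed

section \<open>The Euler-type integral as the analytic continuation of the series\<close>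

definition hypergeo_integral ::
    "real \<Rightarrow> complex \<Rightarrow> complex \<Rightarrow> complex \<Rightarrow> complex \<Rightarrow> complex \<Rightarrow> complex" where
  "hypergeo_integral p \<nu> a b c z =
     complex_of_real (sqrt (2 * p / pi)) / Beta b (c - b) *
     integral {0..1} (\<lambda>t. (1 - z * of_real t) powr (- a) * beta_kernel p \<nu> b (c - b) t)"

lemma cut_plane_eq: "cut_plane = {z. Im z \<noteq> 0} \<union> {z. Re z < 1}"
  by (force simp: cut_plane_def image_iff complex_eq_iff)

lemma open_cut_plane: "open cut_plane"
proof -
  have "open {z. Im z \<noteq> 0}" "open {z. Re z < 1}"
    by (intro open_Collect_neq open_Collect_less continuous_intros)+
  then show ?thesis unfolding cut_plane_eq by (rule open_Un)
qed

text \<open>The cut plane is star-shaped about 0. Hence \<open>1 - z * t\<close> avoids the branch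
  cut of the power for all \<open>t\<close> in the integration interval; connectedness follows as
  well.\<close>

lemma mult_mem_cut_plane:
  assumes "z \<in> cut_plane" "t \<in> {0..1}"
  shows "z * complex_of_real t \<in> cut_plane"
proof (cases "t = 0")
  case False
  have "Re z * t < 1" if "Re z < 1"
    using assms(2) that False by (smt (verit) atLeastAtMost_iff mult_le_one mult_less_cancel_right2 mult_nonpos_nonneg)
  then show ?thesis using assms False by (auto simp: cut_plane_eq)
qed (simp add: cut_plane_eq)

lemma connected_cut_plane: "connected cut_plane"
proof (rule starlike_imp_connected, unfold starlike_def, intro bexI ballI subsetI)
  fix z w assume "z \<in> cut_plane" "w \<in> closed_segment 0 z"
  then obtain t where "t \<in> {0..1}" "w = z * complex_of_real t"
    by (auto simp: closed_segment_def scaleR_conv_of_real mult.commute)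
  then show "w \<in> cut_plane" using mult_mem_cut_plane \<open>z \<in> cut_plane\<close> by simp
qed (simp add: cut_plane_eq)

lemma one_minus_notin_nonpos_Reals: "z \<in> cut_plane \<Longrightarrow> 1 - z \<notin> \<real>\<^sub>\<le>\<^sub>0"
  by (auto simp: cut_plane_eq complex_nonpos_Reals_iff)

lemma continuous_on_powr_const_complex:
  fixes f :: "'a::topological_space \<Rightarrow> complex"
  assumes "continuous_on S f" "\<And>x. x \<in> S \<Longrightarrow> f x \<notin> \<real>\<^sub>\<le>\<^sub>0"
  shows "continuous_on S (\<lambda>x. f x powr a)"
proof -
  have "f x \<noteq> 0" if "x \<in> S" for x using assms(2)[OF that] by auto
  then have "continuous_on S (\<lambda>x. exp (a * Ln (f x)))"
    using assms by (intro continuous_intros) auto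
  then show ?thesis
    by (rule continuous_on_eq) (use \<open>\<And>x. x \<in> S \<Longrightarrow> f x \<noteq> 0\<close> in \<open>simp add: powr_def\<close>)
qed

lemma holomorphic_hypergeo_integral:
  assumes "p > 0"
  shows "hypergeo_integral p \<nu> a b c holomorphic_on cut_plane"
proof -
  let ?k = "beta_kernel p \<nu> b (c - b)"
  let ?G = "\<lambda>z. integral (cbox 0 1) (\<lambda>t. (1 - z * of_real t) powr (- a) * ?k t)"
  note k = continuous_on_beta_kernel[OF assms, of \<nu> b "c - b"]
  have "?G field_differentiable at z" if z: "z \<in> cut_plane" for z
  proof -
    \<comment> \<open>Differentiation under the integral sign is carried out on a convex domain, so
      it is done on a ball around each point.\<close>
    obtain e where e: "e > 0" "ball z e \<subseteq> cut_plane"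
      using open_cut_plane z openE by blast
    have nn: "1 - w * complex_of_real t \<notin> \<real>\<^sub>\<le>\<^sub>0" if "w \<in> ball z e" "t \<in> {0..1}" for w t
      using that e mult_mem_cut_plane by (intro one_minus_notin_nonpos_Reals) auto
    have "?G holomorphic_on ball z e"
    proof (rule leibniz_rule_holomorphic)
      fix w and t :: real assume w: "w \<in> ball z e" and t: "t \<in> cbox 0 1"
      show "((\<lambda>w. (1 - w * of_real t) powr (- a) * ?k t) has_field_derivative
          (- a * (1 - w * of_real t) powr (- a - 1) * (- of_real t)) * ?k t) (at w within ball z e)"
        using nn[OF w] t by (auto intro!: derivative_eq_intros)
    next
      fix w assume w: "w \<in> ball z e"
      show "(\<lambda>t. (1 - w * of_real t) powr (- a) * ?k t) integrable_on cbox 0 1"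
        unfolding box_real using nn[OF w]
        by (intro integrable_continuous_real continuous_intros continuous_on_powr_const_complex k)
    next
      show "continuous_on (ball z e \<times> cbox 0 1) (\<lambda>(w, t).
          (- a * (1 - w * of_real t) powr (- a - 1) * (- of_real t)) * ?k t)"
        unfolding case_prod_beta using nn
        by (intro continuous_intros continuous_on_powr_const_complex continuous_on_compose2[OF k]) auto
    qed simp
    then show ?thesis
      using e(1) by (simp add: holomorphic_on_open field_differentiable_def)
  qed
  then have "?G holomorphic_on cut_plane"
    by (simp add: holomorphic_on_def field_differentiable_at_within)
  then show ?thesis
    unfolding hypergeo_integral_def [abs_def] box_real by (intro holomorphic_intros)
qed

text \<open>The generalised binomial series with exponent \<open>- a\<close> at \<open>- z\<close>:
  the sign from rewriting the binomial coefficient by \<open>pochhammer\<close> cancels that of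
  \<open>(- z) ^ n\<close>.\<close>

lemma pochhammer_powser_sums:
  fixes z a :: complex
  assumes "norm z < 1"
  shows "(\<lambda>n. pochhammer a n / fact n * z ^ n) sums (1 - z) powr (- a)"
proof -
  have "(\<lambda>n. (- a gchoose n) * (- z) ^ n) sums (1 + - z) powr (- a)"
    using assms by (intro gen_binomial_complex) simp
  moreover have "(- a gchoose n) * (- z) ^ n = pochhammer a n / fact n * z ^ n" for n
    by (simp add: gbinomial_pochhammer flip: power_mult_distrib)
  ultimately show ?thesis by simp
qed

lemma ext_hypergeo_series_eq:
  assumes "p > 0" "norm z < 1"
  shows "ext_hypergeo_series p \<nu> a b c z = hypergeo_integral p \<nu> a b c z"
proof -
  let ?k = "beta_kernel p \<nu> b (c - b)"
  let ?d = "\<lambda>n. pochhammer a n / fact n * z ^ n"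
  \<comment> \<open>Convergence at the larger radius \<open>r\<close> yields absolute convergence at
    \<open>z\<close>.\<close>
  obtain r where r: "norm z < r" "r < 1" using dense[OF assms(2)] by blast
  have r0: "r > 0" using r(1) norm_ge_zero le_less_trans by blast
  have "summable (\<lambda>n. norm (?d n))"
  proof (rule powser_insidea)
    show "summable (\<lambda>n. pochhammer a n / fact n * complex_of_real r ^ n)"
      using r r0 by (intro sums_summable[OF pochhammer_powser_sums]) simp
  qed (use r r0 in simp)
  moreover have "(\<lambda>n. ?d n * of_real t ^ n) sums (1 - z * of_real t) powr (- a)" if "t \<in> {0..1}" for t
  proof -
    have "norm z * t \<le> norm z * 1" using that by (intro mult_left_mono) auto
    then have "norm (z * complex_of_real t) < 1" using assms(2) that by (simp add: norm_mult)
    from pochhammer_powser_sums[OF this, of a] show ?thesis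
      by (simp add: power_mult_distrib mult_ac)
  qed
  ultimately have "(\<lambda>n. ?d n * integral {0..1} (\<lambda>t. of_real t ^ n * ?k t)) sums
      integral {0..1} (\<lambda>t. (1 - z * of_real t) powr (- a) * ?k t)"
    by (intro power_moments_sums continuous_on_beta_kernel assms)
  from sums_mult[OF this, of "complex_of_real (sqrt (2 * p / pi)) / Beta b (c - b)"]
  show ?thesis
    unfolding ext_hypergeo_series_def hypergeo_integral_def ext_Beta_eq beta_kernel_add_of_nat
    by (intro sums_unique[symmetric]) (simp add: mult_ac)
qed

text \<open>The integral is one admissible continuation; by the identity theorem on the connected
  cut plane every other one has the same value at \<open>z\<close>.\<close>

lemma ext_hypergeo_eq:
  assumes "p > 0" "z \<in> cut_plane"
  shows "ext_hypergeo p \<nu> a b c z = hypergeo_integral p \<nu> a b c z"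
  unfolding ext_hypergeo_def
proof (rule the_equality)
  show "\<exists>f. f holomorphic_on cut_plane \<and> (\<forall>u\<in>ball 0 1. f u = ext_hypergeo_series p \<nu> a b c u) \<and>
      hypergeo_integral p \<nu> a b c z = f z"
    using holomorphic_hypergeo_integral[OF assms(1)] ext_hypergeo_series_eq[OF assms(1)]
    by (intro exI[of _ "hypergeo_integral p \<nu> a b c"]) auto
next
  fix w assume "\<exists>f. f holomorphic_on cut_plane \<and>
      (\<forall>u\<in>ball 0 1. f u = ext_hypergeo_series p \<nu> a b c u) \<and> w = f z"
  then obtain f where f: "f holomorphic_on cut_plane"
      "\<forall>u\<in>ball 0 1. f u = ext_hypergeo_series p \<nu> a b c u" "w = f z" by blast
  have sub: "ball 0 1 \<subseteq> cut_plane"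
    using complex_Re_le_cmod by (force simp: cut_plane_eq intro: le_less_trans)
  have "f z = hypergeo_integral p \<nu> a b c z"
    by (rule analytic_continuation_open[OF _ open_cut_plane _ connected_cut_plane sub f(1)
          holomorphic_hypergeo_integral[OF assms(1)] _ assms(2)])
       (use f(2) ext_hypergeo_series_eq[OF assms(1)] in auto)
  then show "w = hypergeo_integral p \<nu> a b c z" using f(3) by simp
qed

section \<open>The transformation of the hypergeometric function\<close>

lemma cut_plane_moebius:
  assumes "z \<in> cut_plane"
  shows "- (z / (1 - z)) \<in> cut_plane"
proof (rule ccontr)
  assume "- (z / (1 - z)) \<notin> cut_plane"
  then obtain s :: real where s: "s \<ge> 1" "- (z / (1 - z)) = of_real s"
    by (auto simp: cut_plane_def)
  have "z \<noteq> 1" using assms by (auto simp: cut_plane_eq)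
  with s(2) have "- z = of_real s * (1 - z)" by (simp add: field_simps)
  \<comment> \<open>Here \<open>s = 1\<close> would give \<open>0 = 1\<close>. Otherwise the map,
    being its own inverse, returns \<open>z = s / (s - 1)\<close>, a point of the removed
    ray.\<close>
  then have e: "z * (of_real s - 1) = of_real s" by (simp add: algebra_simps)
  with s have "s \<noteq> 1" by auto
  with e have "z = of_real (s / (s - 1))"
    by (simp add: field_simps)
  moreover have "s / (s - 1) \<ge> 1" using s \<open>s \<noteq> 1\<close> by (simp add: field_simps)
  ultimately show False using assms unfolding cut_plane_def by blast
qed

text \<open>The arguments of the two factors have opposite signs, so the principal branch is
  multiplicative here.\<close>

lemma powr_convex_combination_inverse:
  fixes w a :: complex and t :: real
  assumes "w \<notin> \<real>\<^sub>\<le>\<^sub>0" "t \<in> {0..1}"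
  shows "(w * (1 - of_real t) + of_real t) powr a = w powr a * (1 - of_real t + of_real t / w) powr a"
\<comment> \<open>For \<open>t = 0\<close> the second factor is 1 whatever the sign of
  \<open>Im w\<close>, so the sign equivalences used below require \<open>t > 0\<close>.\<close>
proof (cases "t = 0")
  case False
  define v where "v = 1 - of_real t + of_real t / w"
  have t: "t > 0" using assms False by auto
  have w: "w \<noteq> 0" using assms by auto
  have Im_v: "Im v = - (t * Im w / (norm w)\<^sup>2)"
    by (simp add: v_def Im_divide cmod_power2)
  have sgn: "Im v < 0 \<longleftrightarrow> Im w > 0" "Im v > 0 \<longleftrightarrow> Im w < 0"
    using t w unfolding Im_v by (simp_all add: divide_simps zero_less_mult_iff mult_less_0_iff)
  \<comment> \<open>A real \<open>w\<close> off the cut is positive, hence so is \<open>v\<close>,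
    and its logarithm has argument 0.\<close>
  have real: "Re v > 0" if "Im w = 0"
  proof -
    have "Re w > 0" using assms(1) that by (auto simp: complex_nonpos_Reals_iff)
    moreover have "Re v = 1 - t + t / Re w"
      using that \<open>Re w > 0\<close> by (simp add: v_def Re_divide power2_eq_square)
    ultimately show ?thesis using t assms(2) by (simp add: add_nonneg_pos)
  qed
  have v: "v \<noteq> 0" using sgn real by (metis linorder_neqE_linordered_idom order_less_irrefl zero_complex.simps)
  have neg: "Im (Ln u) < 0" if "Im u < 0" for u
    using that Im_Ln_pos_le[of u] by (cases "u = 0") (auto, meson Im_Ln_le_pi linorder_not_le)
  have "- pi < Im (Ln w) + Im (Ln v) \<and> Im (Ln w) + Im (Ln v) \<le> pi"
  proof (cases "Im w" "0::real" rule: linorder_cases)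
    case less
    then show ?thesis
      using Im_Ln_pos_lt_imp[of v] neg[of w] sgn mpi_less_Im_Ln[OF w] by linarith
  next
    case greater
    then show ?thesis
      using Im_Ln_pos_lt_imp[of w] neg[of v] sgn mpi_less_Im_Ln[OF v] by linarith
  next
    case equal
    then have "Im v = 0" using sgn by linarith
    then have "Im (Ln v) = 0" using real equal v by (simp add: Im_Ln_eq_0)
    then show ?thesis using mpi_less_Im_Ln[OF w] Im_Ln_le_pi[OF w] by simp
  qed
  then have "Ln (w * v) = Ln w + Ln v" using v w by (intro Ln_times_simple) auto
  then have "(w * v) powr a = w powr a * v powr a"
    using v w by (simp add: powr_def exp_add ring_distribs)
  moreover have "w * v = w * (1 - of_real t) + of_real t"
    using w by (simp add: v_def field_simps)
  ultimately show ?thesis by (simp add: v_def)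
qed simp

lemma hypergeo_integral_transform:
  assumes "p > 0" "z \<in> cut_plane"
  shows "hypergeo_integral p \<nu> a b c z =
           (1 - z) powr (- a) * hypergeo_integral p \<nu> a (c - b) c (- (z / (1 - z)))"
proof -
  let ?k = "beta_kernel p \<nu> b (c - b)" and ?k' = "beta_kernel p \<nu> (c - b) b"
  have z1: "z \<noteq> 1" using assms(2) by (auto simp: cut_plane_eq)
  have "1 - z * of_real t \<notin> \<real>\<^sub>\<le>\<^sub>0" if "t \<in> {0..1}" for t
    using that assms mult_mem_cut_plane one_minus_notin_nonpos_Reals by blast
  then have "continuous_on {0..1} (\<lambda>t. (1 - z * of_real t) powr (- a) * ?k t)"
    by (intro continuous_intros continuous_on_powr_const_complex continuous_on_beta_kernel assms(1))
  from integral_reflect01[OF this]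
  have "integral {0..1} (\<lambda>t. (1 - z * of_real t) powr (- a) * ?k t)
      = integral {0..1} (\<lambda>t. (1 - z * of_real (1 - t)) powr (- a) * ?k' t)"
    by (simp add: beta_kernel_reflect)
  also have "\<dots> = integral {0..1} (\<lambda>t. (1 - z) powr (- a) *
      ((1 - (- (z / (1 - z))) * of_real t) powr (- a) * ?k' t))"
  proof (rule integral_cong)
    fix t :: real assume t: "t \<in> {0..1}"
    \<comment> \<open>After reflection the base is a convex combination of \<open>1 - z\<close> and
      1; factoring out \<open>1 - z\<close> leaves the base of the transformed integral.\<close>
    have "1 - z * of_real (1 - t) = (1 - z) * (1 - of_real t) + of_real t"
      by (simp add: algebra_simps)
    moreover have "1 - of_real t + of_real t / (1 - z) = 1 - (- (z / (1 - z))) * of_real t"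
      using z1 by (simp add: field_simps)
    ultimately show "(1 - z * of_real (1 - t)) powr (- a) * ?k' t =
        (1 - z) powr (- a) * ((1 - (- (z / (1 - z))) * of_real t) powr (- a) * ?k' t)"
      using powr_convex_combination_inverse[OF one_minus_notin_nonpos_Reals[OF assms(2)] t, of "- a"]
      by (simp only: mult.assoc)
  qed
  \<comment> \<open>As \<open>c - (c - b) = b\<close>, the symmetry of \<open>Beta\<close> makes the
    two prefactors agree.\<close>
  finally show ?thesis
    by (simp add: hypergeo_integral_def Beta_commute[of b])
qed

section \<open>The confluent function and its transformation\<close>

lemma ext_confluent_eq:
  assumes "p > 0"
  shows "ext_confluent p \<nu> b c z = complex_of_real (sqrt (2 * p / pi)) / Beta b (c - b) *
     integral {0..1} (\<lambda>t. exp (z * of_real t) * beta_kernel p \<nu> b (c - b) t)"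
proof -
  let ?k = "beta_kernel p \<nu> b (c - b)"
  let ?d = "\<lambda>n. z ^ n / fact n"
  have "summable (\<lambda>n. norm (?d n))"
    using summable_norm_exp[of z] by (simp add: scaleR_conv_of_real divide_inverse mult.commute)
  moreover have "(\<lambda>n. ?d n * of_real t ^ n) sums exp (z * of_real t)" for t :: real
    using exp_converges[of "z * of_real t"]
    by (simp add: scaleR_conv_of_real divide_inverse power_mult_distrib mult_ac)
  ultimately have "(\<lambda>n. ?d n * integral {0..1} (\<lambda>t. of_real t ^ n * ?k t)) sums
      integral {0..1} (\<lambda>t. exp (z * of_real t) * ?k t)"
    by (intro power_moments_sums continuous_on_beta_kernel assms)
  from sums_mult[OF this, of "complex_of_real (sqrt (2 * p / pi)) / Beta b (c - b)"]
  show ?thesis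
    unfolding ext_confluent_def ext_Beta_eq beta_kernel_add_of_nat
    by (intro sums_unique[symmetric]) (simp add: mult_ac)
qed

text \<open>Reflection turns \<open>exp (z * t)\<close> into \<open>exp z * exp (- z * t)\<close>;
  the exponential law holds everywhere, so no branch has to be tracked.\<close>

lemma ext_confluent_transform:
  assumes "p > 0"
  shows "ext_confluent p \<nu> b c z = exp z * ext_confluent p \<nu> (c - b) c (- z)"
proof -
  let ?k = "beta_kernel p \<nu> b (c - b)" and ?k' = "beta_kernel p \<nu> (c - b) b"
  have "continuous_on {0..1} (\<lambda>t. exp (z * of_real t) * ?k t)"
    by (intro continuous_intros continuous_on_beta_kernel assms)
  from integral_reflect01[OF this]
  have "integral {0..1} (\<lambda>t. exp (z * of_real t) * ?k t)
      = integral {0..1} (\<lambda>t. exp (z * of_real (1 - t)) * ?k' t)"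
    by (simp add: beta_kernel_reflect)
  also have "(\<lambda>t. exp (z * of_real (1 - t)) * ?k' t) = (\<lambda>t. exp z * (exp (- z * of_real t) * ?k' t))"
    by (simp add: algebra_simps exp_diff exp_minus divide_inverse)
  finally show ?thesis
    by (simp add: ext_confluent_eq[OF assms] Beta_commute[of b])
qed

theorem theorem10:
  fixes p :: real and a b c \<nu> :: complex
  assumes "p > 0" and "Re c > Re b" and "Re b > 0"
  shows "(\<forall>z\<in>cut_plane. ext_hypergeo p \<nu> a b c z =
            (1 - z) powr (- a) * ext_hypergeo p \<nu> a (c - b) c (- (z / (1 - z)))) \<and>
         (\<forall>z. ext_confluent p \<nu> b c z = exp z * ext_confluent p \<nu> (c - b) c (- z))"
proof (intro conjI ballI allI)
  fix z assume "z \<in> cut_plane"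
  then show "ext_hypergeo p \<nu> a b c z =
      (1 - z) powr (- a) * ext_hypergeo p \<nu> a (c - b) c (- (z / (1 - z)))"
    unfolding ext_hypergeo_eq[OF assms(1) \<open>z \<in> cut_plane\<close>]
      ext_hypergeo_eq[OF assms(1) cut_plane_moebius[OF \<open>z \<in> cut_plane\<close>]]
    by (rule hypergeo_integral_transform[OF assms(1)])
qed (rule ext_confluent_transform[OF assms(1)])

end
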